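(* Let $\mathbb{K}$ be $\mathbb{R}$ or $\mathbb{R}_\infty$. For every (finite) system $F$ of min-plus polynomials in $n$ variables over $\mathbb{K}$ there are a (finite) system $T$ of tropical polynomials in $2n$ variables over $\mathbb{K}$ and an injective (classical) linear transformation $H\colon\mathbb{K}^n\to\mathbb{K}^{2n}$ such that the image under $H$ of the set of roots of $F$ coincides with the set of roots of $T$.
   Context: $\mathbb{R}_\infty=\mathbb{R}\cup\{+\infty\}$. Tropical operations on $\mathbb{K}$: $x\oplus y=\min\{x,y\}$, $x\odot y=x+y$. A tropical monomial is $m(\vec x)=c\odot \vec x^{I}$ with $c\in\mathbb{K}$, $I=(i_1,\dots,i_n)\in\mathbb{Z}_{\ge0}^n$ and $\vec x^{I}=i_1x_1+\dots+i_nx_n$ in classical notation (with $0\cdot\infty=0$). A tropical polynomial is a finite tropical sum $f=\min_i m_i$ of monomials with pairwise distinct exponent vectors. A point $\vec a\in\mathbb{K}^n$ is a root of a tropical polynomial $f$ if $\min_i m_i(\vec a)$ is attained on at least two different monomials or is equal to $\infty$. A min-plus polynomial is a pair $(f,g)$ of tropical polynomials; $\vec a\in\mathbb{K}^n$ is a root of $(f,g)$ if $f(\vec a)=g(\vec a)$. A root of a system is a common root of all its members. Over $\mathbb{R}_\infty$, a linear transformation means a map each of whose coordinates is a classical linear form $\sum_j c_jx_j$ with real coefficients $c_j\ge0$, using the convention $0\cdot\infty=0$. *)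

theory Defs
  imports "HOL-Library.Extended_Real" "HOL-Library.FuncSet"
begin

text \<open>
  Both semirings are carriers inside \<^typ>\<open>ereal\<close>, whose order, addition and multiplication
  (with \<open>0 * \<infinity> = 0\<close>) restrict to the classical operations on them.
\<close>

definition Rfin :: "ereal set"
  where "Rfin = range ereal"

definition Rinf :: "ereal set"
  where "Rinf = range ereal \<union> {\<infinity>}"

text \<open>Vectors of length \<open>n\<close> are extensional functions, so that equality of vectors is equality in HOL.\<close>

definition vecs :: "'a set \<Rightarrow> nat \<Rightarrow> (nat \<Rightarrow> 'a) set"
  where "vecs A n = {..<n} \<rightarrow>\<^sub>E A"

text \<open>A monomial is a pair of a coefficient and an exponent vector.\<close>

type_synonym trop_monom = "ereal \<times> (nat \<Rightarrow> nat)"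

type_synonym trop_poly = "trop_monom set"

definition monom_eval :: "nat \<Rightarrow> trop_monom \<Rightarrow> (nat \<Rightarrow> ereal) \<Rightarrow> ereal"
  where "monom_eval n m x = fst m + (\<Sum>j<n. ereal (real (snd m j)) * x j)"

text \<open>
  The sum has at least one monomial: over \<^const>\<open>Rfin\<close> an empty minimum has no value, and over
  \<^const>\<open>Rinf\<close> the polynomial \<open>\<infinity>\<close> is available as a monomial with coefficient \<open>\<infinity>\<close>.
\<close>

definition trop_polys :: "ereal set \<Rightarrow> nat \<Rightarrow> trop_poly set"
  where "trop_polys K n =
    {f. finite f \<and> f \<noteq> {} \<and> f \<subseteq> K \<times> vecs UNIV n \<and> inj_on snd f}"

definition poly_eval :: "nat \<Rightarrow> trop_poly \<Rightarrow> (nat \<Rightarrow> ereal) \<Rightarrow> ereal"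
  where "poly_eval n f x = Min ((\<lambda>m. monom_eval n m x) ` f)"

definition trop_root :: "nat \<Rightarrow> trop_poly \<Rightarrow> (nat \<Rightarrow> ereal) \<Rightarrow> bool"
  where "trop_root n f a \<longleftrightarrow>
    (\<exists>m\<in>f. \<exists>m'\<in>f. m \<noteq> m' \<and> monom_eval n m a = poly_eval n f a
                        \<and> monom_eval n m' a = poly_eval n f a)
    \<or> poly_eval n f a = \<infinity>"

definition trop_roots :: "ereal set \<Rightarrow> nat \<Rightarrow> trop_poly set \<Rightarrow> (nat \<Rightarrow> ereal) set"
  where "trop_roots K n T = {a \<in> vecs K n. \<forall>f\<in>T. trop_root n f a}"

definition minplus_polys :: "ereal set \<Rightarrow> nat \<Rightarrow> (trop_poly \<times> trop_poly) set"
  where "minplus_polys K n = trop_polys K n \<times> trop_polys K n"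

definition minplus_roots ::
    "ereal set \<Rightarrow> nat \<Rightarrow> (trop_poly \<times> trop_poly) set \<Rightarrow> (nat \<Rightarrow> ereal) set"
  where "minplus_roots K n F =
    {a \<in> vecs K n. \<forall>(f, g)\<in>F. poly_eval n f a = poly_eval n g a}"

text \<open>
  Coefficients are arbitrary reals over \<^const>\<open>Rfin\<close>, and nonnegative reals over \<^const>\<open>Rinf\<close>.
\<close>

definition linear_map ::
    "ereal set \<Rightarrow> nat \<Rightarrow> nat \<Rightarrow> ((nat \<Rightarrow> ereal) \<Rightarrow> nat \<Rightarrow> ereal) \<Rightarrow> bool"
  where "linear_map K n m H \<longleftrightarrow>
    H \<in> vecs K n \<rightarrow> vecs K m \<and>
    (\<exists>c :: nat \<Rightarrow> nat \<Rightarrow> real.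
      (K = Rinf \<longrightarrow> (\<forall>i<m. \<forall>j<n. 0 \<le> c i j)) \<and>
      (\<forall>x\<in>vecs K n. \<forall>i<m. H x i = (\<Sum>j<n. ereal (c i j) * x j)))"

end

theory Submission imports Defs begin

text \<open>
  Take \<open>H x = (x, x)\<close>. The tropical polynomial \<open>x\<^sub>i \<oplus> y\<^sub>i\<close> has a root exactly where
  \<open>x\<^sub>i = y\<^sub>i\<close>, so these \<open>n\<close> polynomials cut out the diagonal, that is, the image of \<open>H\<close>
  (\<open>diagonal_root_iff\<close>).

  On the diagonal a tropical polynomial can express an inequality. The equation \<open>f = g\<close> says that
  \<open>g \<le> m\<close> for every monomial \<open>m\<close> of \<open>f\<close> and \<open>f \<le> l\<close> for every monomial \<open>l\<close> of \<open>g\<close>. To express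
  \<open>g \<le> m\<close>, write each monomial of \<open>g\<close> twice, once in the variables \<open>x\<close> and once in the variables
  \<open>y\<close>, and add \<open>m\<close> once. The minimum is then attained twice whenever some
  monomial of \<open>g\<close> attains it, and otherwise only by \<open>m\<close> (\<open>doubled_root_iff\<close>).

  The difficulty is that exponent vectors must be pairwise distinct: a constant
  monomial of \<open>g\<close> has identical copies, and \<open>m\<close> may have the exponent of a monomial of \<open>g\<close>.
  If \<open>m\<close> contains the variable \<open>x\<^sub>i\<close>, multiply the whole polynomial by \<open>x\<^sub>i\<close>, written as
  \<open>x\<^sub>i\<close> or \<open>y\<^sub>i\<close> as needed; \<open>m\<close> becomes \<open>m(x) \<odot> y\<^sub>i\<close>, which involves both blocks of variables.
  No information is lost where \<open>x\<^sub>i = \<infinity>\<close>, because there \<open>m = \<infinity>\<close> and \<open>g \<le> m\<close> holds anyway. If \<open>m\<close>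
  is a constant, such a multiplication could lose information, but it can be avoided: compare \<open>m\<close>
  with the constant term of \<open>g\<close>. Either that term settles \<open>g \<le> m\<close> for all \<open>x\<close>, or it never helps
  and may be dropped (\<open>exists_tropical_system_for_le\<close>).
\<close>

section \<open>Vectors in two blocks of variables\<close>

definition join :: "nat \<Rightarrow> (nat \<Rightarrow> 'a) \<Rightarrow> (nat \<Rightarrow> 'a) \<Rightarrow> nat \<Rightarrow> 'a"
  where "join n u v = (\<lambda>i\<in>{..<2 * n}. if i < n then u i else v (i - n))"

definition zero_exp :: "nat \<Rightarrow> nat \<Rightarrow> nat"
  where "zero_exp n = (\<lambda>j\<in>{..<n}. 0)"

definition incr_exp :: "nat \<Rightarrow> (nat \<Rightarrow> nat) \<Rightarrow> nat \<Rightarrow> nat"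
  where "incr_exp i u = u(i := Suc (u i))"

lemma zero_exp_in_vecs [simp]: "zero_exp n \<in> vecs UNIV n"
  by (simp add: zero_exp_def vecs_def)

lemma incr_exp_in_vecs [simp]:
  assumes "u \<in> vecs UNIV n" "i < n"
  shows "incr_exp i u \<in> vecs UNIV n"
  using assms by (auto simp: incr_exp_def vecs_def PiE_def extensional_def)

lemma inj_incr_exp: "inj (incr_exp i)"
proof (rule injI, rule ext)
  fix u v j
  assume "incr_exp i u = incr_exp i v"
  then have "incr_exp i u j = incr_exp i v j" by simp
  then show "u j = v j"
    by (cases "j = i") (auto simp: incr_exp_def)
qed

lemma incr_exp_neq_zero:
  assumes "i < n"
  shows "incr_exp i u \<noteq> zero_exp n"
proof
  assume "incr_exp i u = zero_exp n"
  then have "incr_exp i u i = zero_exp n i" by simp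
  then show False using assms by (simp add: incr_exp_def zero_exp_def)
qed

lemma exp_neq_zero_imp_pos:
  assumes "u \<in> vecs UNIV n" "u \<noteq> zero_exp n"
  obtains i where "i < n" "u i > 0"
proof -
  have "\<exists>i<n. u i > 0"
  proof (rule ccontr)
    assume "\<not> (\<exists>i<n. u i > 0)"
    then have "u = zero_exp n"
      using assms(1)
      by (intro ext) (auto simp: zero_exp_def vecs_def PiE_def extensional_def)
    with assms(2) show False by contradiction
  qed
  with that show ?thesis by blast
qed

lemma join_in_vecs:
  assumes "u \<in> vecs A n" "v \<in> vecs A n"
  shows "join n u v \<in> vecs A (2 * n)"
  using assms by (auto simp: join_def vecs_def PiE_def Pi_def)

lemma join_exp_in_vecs [simp]: "join n u v \<in> vecs UNIV (2 * n)"
  by (simp add: join_def vecs_def)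

lemma join_eq_iff:
  assumes "u \<in> vecs A n" "v \<in> vecs A n" "u' \<in> vecs A n" "v' \<in> vecs A n"
  shows "join n u v = join n u' v' \<longleftrightarrow> u = u' \<and> v = v'"
proof
  assume eq: "join n u v = join n u' v'"
  have "u i = u' i \<and> v i = v' i" for i
  proof (cases "i < n")
    case True
    from eq have "join n u v i = join n u' v' i" and "join n u v (n + i) = join n u' v' (n + i)"
      by simp_all
    with True show ?thesis by (simp add: join_def)
  next
    case False
    with assms show ?thesis by (auto simp: vecs_def PiE_def extensional_def)
  qed
  then show "u = u' \<and> v = v'" by auto
qed simp

lemma vec_eq_join:
  assumes "z \<in> vecs A (2 * n)"
  obtains x y where "x \<in> vecs A n" "y \<in> vecs A n" "z = join n x y"
proof
  show "(\<lambda>i\<in>{..<n}. z i) \<in> vecs A n" and "(\<lambda>i\<in>{..<n}. z (n + i)) \<in> vecs A n"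
    using assms by (auto simp: vecs_def PiE_def Pi_def)
  show "z = join n (\<lambda>i\<in>{..<n}. z i) (\<lambda>i\<in>{..<n}. z (n + i))"
    using assms by (intro ext) (auto simp: join_def vecs_def PiE_def extensional_def)
qed

section \<open>Evaluating monomials and polynomials\<close>

definition exp_eval :: "nat \<Rightarrow> (nat \<Rightarrow> nat) \<Rightarrow> (nat \<Rightarrow> ereal) \<Rightarrow> ereal"
  where "exp_eval n u x = (\<Sum>j<n. ereal (real (u j)) * x j)"

lemma monom_eval_eq: "monom_eval n m x = fst m + exp_eval n (snd m) x"
  by (simp add: monom_eval_def exp_eval_def)

lemma exp_eval_zero [simp]: "exp_eval n (zero_exp n) x = 0"
  by (simp add: exp_eval_def zero_exp_def flip: zero_ereal_def)

lemma exp_eval_incr: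
  assumes "i < n"
  shows "exp_eval n (incr_exp i u) x = exp_eval n u x + x i"
proof -
  have "ereal (real (Suc (u i))) * x i = (ereal (real (u i)) + 1) * x i"
    by (simp add: one_ereal_def add.commute)
  also have "\<dots> = ereal (real (u i)) * x i + x i"
    by (subst ereal_left_distrib) simp_all
  finally have step: "ereal (real (Suc (u i))) * x i = ereal (real (u i)) * x i + x i" .
  have "exp_eval n (incr_exp i u) x =
      ereal (real (Suc (u i))) * x i + (\<Sum>j\<in>{..<n} - {i}. ereal (real (u j)) * x j)"
    using assms unfolding exp_eval_def
    by (subst sum.remove[of _ i]) (auto simp: incr_exp_def intro!: sum.cong)
  also have "\<dots> = exp_eval n u x + x i"
    using assms unfolding exp_eval_def step
    by (subst (2) sum.remove[of _ i]) (auto simp: ac_simps)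
  finally show ?thesis .
qed

lemma exp_eval_join:
  "exp_eval (2 * n) (join n u v) (join n x y) = exp_eval n u x + exp_eval n v y"
proof -
  let ?h = "\<lambda>j. ereal (real (join n u v j)) * join n x y j"
  have "{..<2 * n} = {..<n} \<union> {n..<2 * n}" by auto
  then have "sum ?h {..<2 * n} = sum ?h {..<n} + sum ?h {n..<2 * n}"
    by (simp add: sum.union_disjoint ivl_disj_int)
  also have "sum ?h {n..<2 * n} = (\<Sum>j<n. ?h (n + j))"
    using sum.shift_bounds_nat_ivl[of ?h 0 n n]
    by (simp add: mult_2 lessThan_atLeast0 add.commute)
  finally show ?thesis
    by (simp add: exp_eval_def join_def)
qed

lemma exp_eval_infinity:
  assumes "i < n" "u i > 0" "x i = \<infinity>"
  shows "exp_eval n u x = \<infinity>"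
  unfolding exp_eval_def sum_Pinfty using assms by (auto intro!: exI[of _ i])

lemma poly_eval_le_iff:
  assumes "finite f" "f \<noteq> {}"
  shows "poly_eval n f x \<le> a \<longleftrightarrow> (\<exists>m\<in>f. monom_eval n m x \<le> a)"
  using assms by (simp add: poly_eval_def Min_le_iff)

lemma le_poly_eval_iff:
  assumes "finite f" "f \<noteq> {}"
  shows "a \<le> poly_eval n f x \<longleftrightarrow> (\<forall>m\<in>f. a \<le> monom_eval n m x)"
  using assms by (simp add: poly_eval_def)

section \<open>Cutting out the diagonal\<close>

definition diagonal_poly :: "nat \<Rightarrow> nat \<Rightarrow> trop_poly"
  where "diagonal_poly n i =
    {(0, join n (incr_exp i (zero_exp n)) (zero_exp n)),
     (0, join n (zero_exp n) (incr_exp i (zero_exp n)))}"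

lemma diagonal_poly_in_trop_polys:
  assumes "0 \<in> K"
  shows "diagonal_poly n i \<in> trop_polys K (2 * n)"
  using assms by (auto simp: diagonal_poly_def trop_polys_def)

lemma diagonal_root_iff:
  assumes "i < n"
  shows "trop_root (2 * n) (diagonal_poly n i) (join n x y) \<longleftrightarrow> x i = y i"
proof -
  let ?a = "(0, join n (incr_exp i (zero_exp n)) (zero_exp n)) :: trop_monom"
  let ?b = "(0, join n (zero_exp n) (incr_exp i (zero_exp n))) :: trop_monom"
  have vals: "monom_eval (2 * n) ?a (join n x y) = x i" "monom_eval (2 * n) ?b (join n x y) = y i"
    using assms by (simp_all add: monom_eval_eq exp_eval_join exp_eval_incr)
  have ne: "?a \<noteq> ?b"
    using assms incr_exp_neq_zero[of i n] by (simp add: join_eq_iff[where A = UNIV])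
  have pe: "poly_eval (2 * n) (diagonal_poly n i) (join n x y) = min (x i) (y i)"
    by (simp add: poly_eval_def diagonal_poly_def vals)
  show ?thesis
  proof
    assume "x i = y i"
    then show "trop_root (2 * n) (diagonal_poly n i) (join n x y)"
      unfolding trop_root_def pe using ne vals by (auto simp: diagonal_poly_def)
  next
    assume "trop_root (2 * n) (diagonal_poly n i) (join n x y)"
    then consider "x i = min (x i) (y i)" "y i = min (x i) (y i)" | "min (x i) (y i) = \<infinity>"
      unfolding trop_root_def pe using ne vals by (auto simp: diagonal_poly_def)
    then show "x i = y i"
      by cases (metis, auto simp: min_def split: if_splits)
  qed
qed

section \<open>Expressing inequalities on the diagonal\<close>

definition doubled_poly :: "nat \<Rightarrow> trop_monom \<Rightarrow> trop_monom set \<Rightarrow> trop_poly"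
  where "doubled_poly n m G = insert m
    ((\<lambda>l. (fst l, join n (snd l) (zero_exp n))) ` G \<union>
     (\<lambda>l. (fst l, join n (zero_exp n) (snd l))) ` G)"

lemma doubled_poly_in_trop_polys:
  assumes G: "finite G" "G \<subseteq> K \<times> vecs UNIV n" "inj_on snd G" "zero_exp n \<notin> snd ` G"
    and m: "fst m \<in> K" "snd m \<in> vecs UNIV (2 * n)"
    and distinct: "\<And>l. l \<in> G \<Longrightarrow> snd m \<noteq> join n (snd l) (zero_exp n)"
      "\<And>l. l \<in> G \<Longrightarrow> snd m \<noteq> join n (zero_exp n) (snd l)"
  shows "doubled_poly n m G \<in> trop_polys K (2 * n)"
proof -
  have V: "snd l \<in> vecs UNIV n" "snd l \<noteq> zero_exp n" if "l \<in> G" for l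
    using that G(2,4) by force+
  have LL: "join n (snd l) (zero_exp n) = join n (snd l') (zero_exp n) \<longleftrightarrow> l = l'"
    and RR: "join n (zero_exp n) (snd l) = join n (zero_exp n) (snd l') \<longleftrightarrow> l = l'"
    and LR: "join n (snd l) (zero_exp n) \<noteq> join n (zero_exp n) (snd l')"
    if "l \<in> G" "l' \<in> G" for l l'
    using that V G(3) by (auto simp: join_eq_iff[where A = UNIV] dest: inj_onD)
  have "inj_on snd (doubled_poly n m G)"
    unfolding doubled_poly_def inj_on_def ball_simps ball_Un
    by (simp add: LL RR LR LR[symmetric] distinct distinct[symmetric])
  moreover have "doubled_poly n m G \<subseteq> K \<times> vecs UNIV (2 * n)"
    using G(2) m by (force simp: doubled_poly_def mem_Times_iff)
  ultimately show ?thesis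
    using G(1) by (auto simp: trop_polys_def doubled_poly_def)
qed

text \<open>
  A minimum attained at a copy of a monomial of \<open>G\<close> is attained at its other copy too; the two
  copies are different monomials because no exponent in \<open>G\<close> vanishes. If \<open>m\<close> has the value
  \<open>\<infinity>\<close>, the point is always a root: some monomial of \<open>G\<close> attains the minimum, or \<open>G\<close> is
  empty and the minimum is \<open>\<infinity>\<close>.
\<close>

lemma doubled_root_iff:
  assumes G: "finite G" "snd ` G \<subseteq> vecs UNIV n" "zero_exp n \<notin> snd ` G"
  shows "trop_root (2 * n) (doubled_poly n m G) (join n x x) \<longleftrightarrow>
    monom_eval (2 * n) m (join n x x) = \<infinity> \<or>
    (\<exists>l\<in>G. monom_eval n l x \<le> monom_eval (2 * n) m (join n x x))"
    (is "?root \<longleftrightarrow> ?v m = \<infinity> \<or> (\<exists>l\<in>G. _ l \<le> ?v m)")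
proof -
  let ?P = "doubled_poly n m G"
  let ?L = "\<lambda>l. (fst l, join n (snd l) (zero_exp n))"
  let ?R = "\<lambda>l. (fst l, join n (zero_exp n) (snd l))"
  let ?min = "poly_eval (2 * n) ?P (join n x x)"
  have fin: "finite ?P" "?P \<noteq> {}" using G(1) by (auto simp: doubled_poly_def)
  have vals: "?v (?L l) = monom_eval n l x" "?v (?R l) = monom_eval n l x" for l
    by (simp_all add: monom_eval_eq exp_eval_join)
  have ne: "?L l \<noteq> ?R l" if "l \<in> G" for l
  proof -
    have "snd l \<in> vecs UNIV n" "snd l \<noteq> zero_exp n" using that G(2,3) by force+
    then show ?thesis by (simp add: join_eq_iff[where A = UNIV])
  qed
  have min_le: "?min \<le> ?v q" if "q \<in> ?P" for q
    using that le_poly_eval_iff[OF fin, of ?min] by blast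
  have m_in: "m \<in> ?P" by (simp add: doubled_poly_def)
  show ?thesis
  proof
    assume ?root
    then consider (twice) q q' where "q \<in> ?P" "q' \<in> ?P" "q \<noteq> q'" "?v q = ?min" "?v q' = ?min"
      | (inf) "?min = \<infinity>"
      unfolding trop_root_def by blast
    then show "?v m = \<infinity> \<or> (\<exists>l\<in>G. monom_eval n l x \<le> ?v m)"
    proof cases
      case twice
      then obtain q'' where "q'' \<in> ?P" "q'' \<noteq> m" "?v q'' = ?min" by metis
      then obtain l where "l \<in> G" "monom_eval n l x = ?min"
        using vals by (auto simp: doubled_poly_def)
      with min_le[OF m_in] show ?thesis by metis
    next
      case inf
      with min_le[OF m_in] show ?thesis by simp
    qed
  next
    assume rhs: "?v m = \<infinity> \<or> (\<exists>l\<in>G. monom_eval n l x \<le> ?v m)"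
    show ?root
    proof (cases "G = {}")
      case True
      with rhs show ?thesis
        by (simp add: trop_root_def poly_eval_def doubled_poly_def)
    next
      case False
      have "poly_eval n G x \<in> (\<lambda>l. monom_eval n l x) ` G"
        unfolding poly_eval_def using G(1) False by (intro Min_in) auto
      then obtain l where l: "l \<in> G" "monom_eval n l x = poly_eval n G x"
        by (metis imageE)
      have l_le: "monom_eval n l x \<le> monom_eval n l' x" if "l' \<in> G" for l'
        using that le_poly_eval_iff[OF G(1) False, of "monom_eval n l x"] l(2) by auto
      have "monom_eval n l x \<le> ?v m"
        using rhs l_le False by (auto intro: order_trans)
      then have "monom_eval n l x \<le> ?v q" if "q \<in> ?P" for q
        using that vals l_le by (auto simp: doubled_poly_def)
      then have "monom_eval n l x \<le> ?min"
        using le_poly_eval_iff[OF fin] by blast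
      moreover have in_P: "?L l \<in> ?P" "?R l \<in> ?P"
        using l(1) by (auto simp: doubled_poly_def)
      ultimately have "?v (?L l) = ?min" "?v (?R l) = ?min"
        using min_le[OF in_P(1)] vals by (auto intro: antisym)
      then show ?thesis
        unfolding trop_root_def using in_P ne[OF l(1)] by blast
    qed
  qed
qed

text \<open>
  Systems rather than single polynomials, since for a constant \<open>m\<close> the inequality may hold
  everywhere; the empty system then expresses it. In the last case, the factor \<open>x\<^sub>i\<close> is chosen to
  occur in \<open>m\<close>, so that cancelling it is harmless also where it is \<open>\<infinity>\<close>.
\<close>

lemma exists_tropical_system_for_le:
  assumes K: "K = Rfin \<or> K = Rinf"
    and g: "g \<in> trop_polys K n" and m: "m \<in> K \<times> vecs UNIV n"
  shows "\<exists>T. finite T \<and> T \<subseteq> trop_polys K (2 * n) \<and>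
    (\<forall>x\<in>vecs K n. (\<forall>p\<in>T. trop_root (2 * n) p (join n x x)) \<longleftrightarrow>
      poly_eval n g x \<le> monom_eval n m x)"
proof -
  have g': "finite g" "g \<noteq> {}" "g \<subseteq> K \<times> vecs UNIV n" "inj_on snd g"
    using g by (auto simp: trop_polys_def)
  note g_le = poly_eval_le_iff[OF g'(1,2)]
  have mK: "fst m \<in> K" "snd m \<in> vecs UNIV n" using m by auto
  consider (settled) l where "l \<in> g" "snd l = zero_exp n" "snd m = zero_exp n" "fst l \<le> fst m"
    | (const) "snd m = zero_exp n" "\<And>l. l \<in> g \<Longrightarrow> snd l = zero_exp n \<Longrightarrow> \<not> fst l \<le> fst m"
    | (nonconst) "snd m \<noteq> zero_exp n" by blast
  then show ?thesis
  proof cases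
    case settled
    then have "poly_eval n g x \<le> monom_eval n m x" for x
      unfolding g_le by (intro bexI[of _ l]) (simp_all add: monom_eval_eq)
    then show ?thesis by (intro exI[of _ "{}"]) simp
  next
    case const
    define G where "G = {l \<in> g. snd l \<noteq> zero_exp n}"
    define M :: trop_monom where "M = (fst m, join n (zero_exp n) (zero_exp n))"
    have G: "finite G" "G \<subseteq> K \<times> vecs UNIV n" "inj_on snd G" "zero_exp n \<notin> snd ` G"
      using g' by (auto simp: G_def inj_on_def)
    have GV: "snd l \<in> vecs UNIV n" "snd l \<noteq> zero_exp n" if "l \<in> G" for l
      using that G(2,4) by force+
    have "doubled_poly n M G \<in> trop_polys K (2 * n)"
      using G mK GV
      by (intro doubled_poly_in_trop_polys) (auto simp: M_def join_eq_iff[where A = UNIV])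
    moreover have "trop_root (2 * n) (doubled_poly n M G) (join n x x) \<longleftrightarrow>
        poly_eval n g x \<le> monom_eval n m x" for x
    proof -
      have "monom_eval (2 * n) M (join n x x) = fst m" "monom_eval n m x = fst m"
        using const(1) by (simp_all add: M_def monom_eval_eq exp_eval_join)
      moreover have "snd ` G \<subseteq> vecs UNIV n" using GV by blast
      moreover have "(\<exists>l\<in>g. monom_eval n l x \<le> fst m) \<longleftrightarrow>
          fst m = \<infinity> \<or> (\<exists>l\<in>G. monom_eval n l x \<le> fst m)"
        using const(2) g'(2) by (force simp: G_def monom_eval_eq)
      ultimately show ?thesis
        using G(1,4) by (simp add: doubled_root_iff g_le)
    qed
    ultimately show ?thesis
      by (intro exI[of _ "{doubled_poly n M G}"]) simp
  next
    case nonconst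
    then obtain i where i: "i < n" "snd m i > 0"
      using mK(2) exp_neq_zero_imp_pos by blast
    define G where "G = (\<lambda>l. (fst l, incr_exp i (snd l))) ` g"
    define M :: trop_monom where "M = (fst m, join n (snd m) (incr_exp i (zero_exp n)))"
    have gV: "snd l \<in> vecs UNIV n" if "l \<in> g" for l
      using that g'(3) by force
    have G: "finite G" "G \<subseteq> K \<times> vecs UNIV n" "inj_on snd G" "zero_exp n \<notin> snd ` G"
      using g' gV i(1)
      by (auto simp: G_def inj_on_def inj_eq[OF inj_incr_exp]
          incr_exp_neq_zero[OF i(1), symmetric])
    have GV: "snd l \<in> vecs UNIV n" "snd l \<noteq> zero_exp n" if "l \<in> G" for l
      using that G(2,4) by force+
    have "doubled_poly n M G \<in> trop_polys K (2 * n)"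
      using G mK GV nonconst i(1) incr_exp_neq_zero[OF i(1)]
      by (intro doubled_poly_in_trop_polys) (auto simp: M_def join_eq_iff[where A = UNIV])
    moreover have "trop_root (2 * n) (doubled_poly n M G) (join n x x) \<longleftrightarrow>
        poly_eval n g x \<le> monom_eval n m x" if x: "x \<in> vecs K n" for x
    proof -
      have valM: "monom_eval (2 * n) M (join n x x) = monom_eval n m x + x i"
        using i(1) by (simp add: M_def monom_eval_eq exp_eval_join exp_eval_incr add.assoc)
      have valG: "(\<exists>l\<in>G. monom_eval n l x \<le> a) \<longleftrightarrow> (\<exists>l\<in>g. monom_eval n l x + x i \<le> a)" for a
        using i(1) by (simp add: G_def monom_eval_eq exp_eval_incr add.assoc)
      have "snd ` G \<subseteq> vecs UNIV n" using GV by blast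
      then have root: "trop_root (2 * n) (doubled_poly n M G) (join n x x) \<longleftrightarrow>
          monom_eval n m x + x i = \<infinity> \<or>
          (\<exists>l\<in>g. monom_eval n l x + x i \<le> monom_eval n m x + x i)"
        using G(1,4) by (simp add: doubled_root_iff valM valG)
      have "x i \<in> K" using x i(1) by (auto simp: vecs_def)
      then have "x i = \<infinity> \<or> x i \<in> range ereal"
        using K unfolding Rfin_def Rinf_def by blast
      then consider (inf) "x i = \<infinity>" | (real) r where "x i = ereal r"
        by blast
      then show ?thesis
      proof cases
        case inf
        then have "monom_eval n m x = \<infinity>"
          using i by (simp add: monom_eval_eq exp_eval_infinity)
        with inf show ?thesis by (simp add: root)
      next
        case real
        have cancel: "a + x i \<le> b + x i \<longleftrightarrow> a \<le> b" "b + x i = \<infinity> \<longleftrightarrow> b = \<infinity>" for a b :: ereal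
          unfolding real by (cases a; cases b; simp) (cases b; simp)
        show ?thesis
          unfolding root cancel g_le using g'(2) by auto
      qed
    qed
    ultimately show ?thesis
      by (intro exI[of _ "{doubled_poly n M G}"]) simp
  qed
qed

section \<open>Translating a min-plus system\<close>

lemma poly_eval_eq_iff_le_monoms:
  assumes "f \<in> trop_polys K n" "g \<in> trop_polys K n"
  shows "poly_eval n f x = poly_eval n g x \<longleftrightarrow>
    (\<forall>m\<in>f. poly_eval n g x \<le> monom_eval n m x) \<and> (\<forall>m\<in>g. poly_eval n f x \<le> monom_eval n m x)"
  using assms unfolding order.eq_iff[of "poly_eval n f x"]
  by (auto simp: trop_polys_def le_poly_eval_iff)

lemma linear_map_diagonal: "linear_map K n (2 * n) (\<lambda>x. join n x x)"
proof -
  have "join n x x i = (\<Sum>j<n. ereal (if j = (if i < n then i else i - n) then 1 else 0) * x j)"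
    if "i < 2 * n" for x :: "nat \<Rightarrow> ereal" and i
  proof -
    let ?k = "if i < n then i else i - n"
    have "(\<Sum>j<n. ereal (if j = ?k then 1 else 0) * x j) = (\<Sum>j<n. if j = ?k then x j else 0)"
      by (intro sum.cong) (auto simp flip: zero_ereal_def one_ereal_def)
    also have "\<dots> = x ?k" using that by (subst sum.delta) auto
    finally show ?thesis using that by (simp add: join_def)
  qed
  then show ?thesis
    unfolding linear_map_def
    by (intro conjI exI[of _ "\<lambda>i j. if j = (if i < n then i else i - n) then 1 else 0"])
      (auto simp: join_in_vecs)
qed

theorem lemma17:
  fixes K :: "ereal set" and n :: nat and F :: "(trop_poly \<times> trop_poly) set"
  assumes "K = Rfin \<or> K = Rinf"
    and "finite F" and "F \<subseteq> minplus_polys K n"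
  shows "\<exists>T H. finite T \<and> T \<subseteq> trop_polys K (2 * n) \<and>
           linear_map K n (2 * n) H \<and> inj_on H (vecs K n) \<and>
           H ` minplus_roots K n F = trop_roots K (2 * n) T"
proof -
  \<comment> \<open>\<open>(m, g) \<in> P\<close> stands for the requirement \<open>g \<le> m\<close>.\<close>
  define P where "P = (\<Union>(f, g)\<in>F. f \<times> {g} \<union> g \<times> {f})"
  have F: "f \<in> trop_polys K n" "g \<in> trop_polys K n" if "(f, g) \<in> F" for f g
    using that assms(3) by (auto simp: minplus_polys_def)
  have "finite f \<and> finite g" if "(f, g) \<in> F" for f g
    using F[OF that] by (simp add: trop_polys_def)
  then have finP: "finite P" using assms(2) by (auto simp: P_def)
  have "\<forall>q\<in>P. \<exists>T. finite T \<and> T \<subseteq> trop_polys K (2 * n) \<and>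
    (\<forall>x\<in>vecs K n. (\<forall>p\<in>T. trop_root (2 * n) p (join n x x)) \<longleftrightarrow>
      poly_eval n (snd q) x \<le> monom_eval n (fst q) x)"
  proof
    fix q assume "q \<in> P"
    then have "snd q \<in> trop_polys K n" "fst q \<in> K \<times> vecs UNIV n"
      using F unfolding P_def trop_polys_def by fastforce+
    then show "\<exists>T. finite T \<and> T \<subseteq> trop_polys K (2 * n) \<and>
      (\<forall>x\<in>vecs K n. (\<forall>p\<in>T. trop_root (2 * n) p (join n x x)) \<longleftrightarrow>
        poly_eval n (snd q) x \<le> monom_eval n (fst q) x)"
      by (rule exists_tropical_system_for_le[OF assms(1)])
  qed
  then obtain S where S: "\<And>q. q \<in> P \<Longrightarrow> finite (S q)" "\<And>q. q \<in> P \<Longrightarrow> S q \<subseteq> trop_polys K (2 * n)"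
      "\<And>q x. q \<in> P \<Longrightarrow> x \<in> vecs K n \<Longrightarrow> (\<forall>p\<in>S q. trop_root (2 * n) p (join n x x)) \<longleftrightarrow>
        poly_eval n (snd q) x \<le> monom_eval n (fst q) x"
    by (metis (no_types, lifting))
  define T where "T = diagonal_poly n ` {..<n} \<union> (\<Union>q\<in>P. S q)"
  have "0 \<in> K"
    using assms(1) by (auto simp: Rfin_def Rinf_def zero_ereal_def)
  then have "finite T" "T \<subseteq> trop_polys K (2 * n)"
    using finP S(1,2) diagonal_poly_in_trop_polys by (fastforce simp: T_def)+
  moreover have "inj_on (\<lambda>x. join n x x) (vecs K n)"
    by (auto simp: inj_on_def join_eq_iff[where A = K])
  moreover have "(\<lambda>x. join n x x) ` minplus_roots K n F = trop_roots K (2 * n) T"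
  proof -
    have eq_iff_le: "poly_eval n (fst p) x = poly_eval n (snd p) x \<longleftrightarrow>
        (\<forall>m\<in>fst p. poly_eval n (snd p) x \<le> monom_eval n m x) \<and>
        (\<forall>m\<in>snd p. poly_eval n (fst p) x \<le> monom_eval n m x)" if "p \<in> F" for p x
      using F[of "fst p" "snd p"] that by (simp add: poly_eval_eq_iff_le_monoms)
    have on_diag: "(\<forall>q\<in>P. \<forall>p\<in>S q. trop_root (2 * n) p (join n x x)) \<longleftrightarrow> x \<in> minplus_roots K n F"
      if "x \<in> vecs K n" for x
    proof -
      have "(\<forall>q\<in>P. \<forall>p\<in>S q. trop_root (2 * n) p (join n x x)) \<longleftrightarrow>
          (\<forall>q\<in>P. poly_eval n (snd q) x \<le> monom_eval n (fst q) x)"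
        using S(3) that by blast
      also have "\<dots> \<longleftrightarrow> (\<forall>(f, g)\<in>F. poly_eval n f x = poly_eval n g x)"
        by (simp add: P_def split_beta ball_Un eq_iff_le)
      finally show ?thesis using that by (simp add: minplus_roots_def)
    qed
    have diag: "(\<forall>i<n. trop_root (2 * n) (diagonal_poly n i) (join n x y)) \<longleftrightarrow> x = y"
      if "x \<in> vecs K n" "y \<in> vecs K n" for x y
      using PiE_ext[OF that[unfolded vecs_def]] by (auto simp: diagonal_root_iff)
    show ?thesis
    proof (intro equalityI subsetI)
      fix z assume "z \<in> (\<lambda>x. join n x x) ` minplus_roots K n F"
      then obtain x where x: "x \<in> minplus_roots K n F" "z = join n x x" by blast
      then have "x \<in> vecs K n" by (simp add: minplus_roots_def)
      with x show "z \<in> trop_roots K (2 * n) T"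
        using on_diag[of x] diag[of x x] by (auto simp: trop_roots_def T_def join_in_vecs)
    next
      fix z assume z: "z \<in> trop_roots K (2 * n) T"
      then obtain x y where xy: "x \<in> vecs K n" "y \<in> vecs K n" "z = join n x y"
        using vec_eq_join[of z K n] by (auto simp: trop_roots_def)
      with z have "x = y"
        using diag[OF xy(1,2)] by (auto simp: trop_roots_def T_def)
      with z xy show "z \<in> (\<lambda>x. join n x x) ` minplus_roots K n F"
        using on_diag[OF xy(1)] by (auto simp: trop_roots_def T_def)
    qed
  qed
  ultimately show ?thesis
    using linear_map_diagonal by (intro exI[of _ T] exI[of _ "\<lambda>x. join n x x"] conjI)
qed

end
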